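(* Let $m\ge 1$, $n=2m$, $q=2^m$, let $\omega$ be a primitive element of $\mathbb{F}_{q^2}$ and $u=\omega^{(q-1)(2^{n-1}-1)}$, so that $u$ generates $\mu_{q+1}$ and $\mathbb{F}_{q^2}^*$ is the disjoint union of the cosets $u^i\mathbb{F}_q^*$, $i\in\mathbb{Z}_{q+1}$. Let $r_0,\dots,r_q$ be non-negative integers and $a_0,\dots,a_q\in\mathbb{F}_{q^2}$. Put $R_0=\{i\in\mathbb{Z}_{q+1}: r_i\equiv 0 \pmod{q-1}\}$ and $R_1=\{i\in\mathbb{Z}_{q+1}: r_i\equiv 2^{t_i}\pmod{q-1}\text{ for some integer } t_i\}$ (for $i\in R_1$ such a $t_i$ is fixed), and assume $\#R_0+\#R_1=q+1$. Define $f:\mathbb{F}_{q^2}\to\mathbb{F}_2$ by $f(0)=0$ and $f(x)={\rm Tr}_1^n(a_ix^{r_i})$ if $x\in u^i\mathbb{F}_q^*$, $i\in\mathbb{Z}_{q+1}$. For $i\in\mathbb{Z}_{q+1}$ let $\alpha_i=a_iu^{ir_i}+a_i^qu^{-ir_i}\in\mathbb{F}_q$, let $M_0=\sum_{i\in R_0}(-1)^{{\rm Tr}_1^m(\alpha_i)}$, and for $i\in R_1$ and $b\in\mathbb{F}_{q^2}$ let $T_i(b)=1$ if $bu^i+b^qu^{-i}=\alpha_i^{2^{-t_i}}$ and $T_i(b)=0$ otherwise. Then for every $b\in\mathbb{F}_{q^2}$: $$\widehat{f}(b)=\begin{cases} q\big(M_0+\sum_{i\in R_1}T_i(b)\big)-(M_0+\#R_1-1),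 & b=0,\\ q\big((-1)^{{\rm Tr}_1^m(\alpha_t)}+\sum_{i\in R_1}T_i(b)\big)-(M_0+\#R_1-1), & b^{q-1}=u^{2t},\ t\in R_0,\\ q\sum_{i\in R_1}T_i(b)-(M_0+\#R_1-1), & b^{q-1}=u^{2t},\ t\in R_1.\end{cases}$$
   Context: ${\rm Tr}_1^k(x)=\sum_{j=0}^{k-1}x^{2^j}$ denotes the absolute trace of $\mathbb{F}_{2^k}$; $\mu_e=\{x: x^e=1\}$. For a Boolean function $f:\mathbb{F}_{2^n}\to\mathbb{F}_2$, the Walsh transform is $\widehat{f}(b)=\sum_{x\in\mathbb{F}_{2^n}}(-1)^{f(x)+{\rm Tr}_1^n(bx)}$. For $y\in\mathbb{F}_q$, $y^{2^{-t}}$ denotes the unique $z\in\mathbb{F}_q$ with $z^{2^t}=y$. *)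

theory Defs
  imports "HOL-Library.Cardinality" "HOL-Number_Theory.Cong"
begin

definition primitive_elem :: "'a::{field,finite} \<Rightarrow> bool" where
  "primitive_elem w \<longleftrightarrow> range (\<lambda>k::nat. w ^ k) = UNIV - {0}"

(* The subfield with q elements, as the set of fixed points of the q-power map;
   meant for 'a a finite field with q^2 elements. *)
definition subfield_Fq :: "nat \<Rightarrow> 'a::{field,finite} set" where
  "subfield_Fq q = {x. x ^ q = x}"

(* The absolute trace of the field with 2^k elements, which is a subfield of 'a.
   Its values lie in the prime field {0,1} of 'a, which plays the role of F_2 throughout. *)
definition Tr :: "nat \<Rightarrow> 'a::{field,finite} \<Rightarrow> 'a" where
  "Tr k x = (\<Sum>j<k. x ^ (2 ^ j))"

(* (-1)^c for c in the prime field {0,1} of 'a; a junk value for all other c *)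
definition minus_one_pow :: "'a::{field,finite} \<Rightarrow> int" where
  "minus_one_pow c = (if c = 0 then 1 else -1)"

definition walsh :: "nat \<Rightarrow> ('a::{field,finite} \<Rightarrow> 'a) \<Rightarrow> 'a \<Rightarrow> int" where
  "walsh n f b = (\<Sum>x\<in>UNIV. minus_one_pow (f x + Tr n (b * x)))"

(* r is congruent to 2^t modulo N for an arbitrary integer t, where N is odd, so that 2 is
   invertible modulo N. One of nat t and nat (- t) is 0, so this reads r = 2^t (mod N) if t \<ge> 0
   and r * 2^(-t) = 1 (mod N) if t < 0. *)
definition cong_pow2 :: "nat \<Rightarrow> int \<Rightarrow> nat \<Rightarrow> bool" where
  "cong_pow2 r t N \<longleftrightarrow> [r * 2 ^ nat (- t) = 2 ^ nat t] (mod N)"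

(* y^(2^(-t)) for y in F_q: the unique z in F_q with z^(2^t) = y; for negative t this is
   the power y^(2^(-t)) itself. *)
definition root_pow2 :: "nat \<Rightarrow> int \<Rightarrow> 'a::{field,finite} \<Rightarrow> 'a" where
  "root_pow2 q t y = (THE z. z \<in> subfield_Fq q \<and> z ^ (2 ^ nat t) = y ^ (2 ^ nat (- t)))"

end

(* Every nonzero x is uniquely u^i * y with i in Z_{q+1} and y in F_q^*. Since Tr_1^n is the
   composition of z + z^q with Tr_1^m, the i-th coset contributes to the Walsh transform at b the sum
   over y in F_q^* of (-1)^Tr_1^m(alpha_i y^r_i + c_i y), where c_i = b u^i + b^q u^(-i).
   For i in R0 the power y^r_i is 1, and for i in R1 Frobenius invariance of the trace turns
   alpha_i y^r_i into alpha_i^(2^(-t_i)) y, so that in both cases a sum of a linear character of F_q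
   remains. Finally, for b nonzero c_i vanishes exactly if b^(q-1) = u^(2i), that is, for a single i
   because u has odd order q + 1. *)

theory Submission
  imports Defs "HOL-Computational_Algebra.Polynomial"
begin

section \<open>Finite fields of characteristic two\<close>

text \<open>Multiplication by \<open>x\<close> permutes the nonzero elements, so their product P
  satisfies x^(N-1) P = P, where N is the size of the field, and P can be cancelled.\<close>

lemma power_card_minus_1:
  fixes x :: "'a::{field,finite}"
  assumes "x \<noteq> 0"
  shows "x ^ (CARD('a) - 1) = 1"
proof -
  have "(\<Prod>y\<in>UNIV-{0}. x * y) = (\<Prod>y\<in>UNIV-{0}. y)"
    by (rule prod.reindex_bij_witness[of _ "\<lambda>y. y / x" "\<lambda>y. x * y"]) (use assms in auto)
  moreover have "(\<Prod>y\<in>UNIV-{0}. x * y) = x ^ (CARD('a) - 1) * (\<Prod>y\<in>UNIV-{0}. y)"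
    by (simp add: prod.distrib)
  moreover have "(\<Prod>y\<in>UNIV-{0::'a}. y) \<noteq> 0"
    by simp
  ultimately show ?thesis
    by simp
qed

lemma primitive_elem_nonzero: "primitive_elem w \<Longrightarrow> w \<noteq> 0"
  using rangeI[of "\<lambda>k. w ^ k" 1] unfolding primitive_elem_def by auto

lemma power_mod_eq:
  fixes x :: "'a::monoid_mult"
  assumes "x ^ N = 1"
  shows "x ^ (k mod N) = x ^ k"
proof -
  have "x ^ k = x ^ (N * (k div N) + k mod N)"
    by simp
  also have "\<dots> = x ^ (k mod N)"
    unfolding power_add power_mult using assms by simp
  finally show ?thesis ..
qed

lemma primitive_elem_power_mod:
  fixes w :: "'a::{field,finite}"
  assumes "primitive_elem w"
  shows "w ^ (k mod (CARD('a) - 1)) = w ^ k"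
  by (intro power_mod_eq power_card_minus_1 primitive_elem_nonzero assms)

lemma CARD_field_gt_1: "CARD('a::{field,finite}) > 1"
proof -
  have "card {0, 1::'a} \<le> CARD('a)"
    by (rule card_mono) auto
  then show ?thesis by simp
qed

lemma primitive_elem_image:
  fixes w :: "'a::{field,finite}"
  assumes "primitive_elem w"
  shows "(\<lambda>k. w ^ k) ` {..<CARD('a) - 1} = UNIV - {0}"
proof -
  have "w ^ k \<in> (\<lambda>k. w ^ k) ` {..<CARD('a) - 1}" for k
    using primitive_elem_power_mod[OF assms, of k] CARD_field_gt_1[where 'a='a]
    by (intro image_eqI[of _ _ "k mod (CARD('a) - 1)"]) auto
  then have "range (\<lambda>k. w ^ k) \<subseteq> (\<lambda>k. w ^ k) ` {..<CARD('a) - 1}"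
    by (rule image_subsetI)
  then have "(\<lambda>k. w ^ k) ` {..<CARD('a) - 1} = range (\<lambda>k. w ^ k)"
    using image_mono[OF subset_UNIV] by (rule equalityI[rotated])
  then show ?thesis
    using assms unfolding primitive_elem_def by simp
qed

text \<open>The exponents are exactly as many as the nonzero elements they reach, so no two of them
  can collide.\<close>

lemma primitive_elem_inj_on:
  fixes w :: "'a::{field,finite}"
  assumes "primitive_elem w"
  shows "inj_on (\<lambda>k. w ^ k) {..<CARD('a) - 1}"
proof (rule eq_card_imp_inj_on)
  show "card ((\<lambda>k. w ^ k) ` {..<CARD('a) - 1}) = card {..<CARD('a) - 1}"
    unfolding primitive_elem_image[OF assms] by (simp add: card_Diff_singleton)
qed simp

lemma primitive_elem_power_eq_1_iff:
  fixes w :: "'a::{field,finite}"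
  assumes "primitive_elem w"
  shows "w ^ k = 1 \<longleftrightarrow> (CARD('a) - 1) dvd k"
proof -
  have "w ^ k = 1 \<longleftrightarrow> w ^ (k mod (CARD('a) - 1)) = w ^ 0"
    unfolding primitive_elem_power_mod[OF assms] by simp
  also have "\<dots> \<longleftrightarrow> k mod (CARD('a) - 1) = 0"
    using CARD_field_gt_1[where 'a='a]
    by (intro inj_on_eq_iff[OF primitive_elem_inj_on[OF assms]]) auto
  finally show ?thesis
    by (simp add: dvd_eq_mod_eq_0)
qed

text \<open>The multiplicative group has odd order, so raising -1 to that order gives both -1 and
  1.\<close>

lemma even_CARD_imp_CHAR_2:
  assumes "even CARD('a::{field,finite})"
  shows "CHAR('a) = 2"
proof -
  have "odd (CARD('a) - 1)"
    using assms CARD_field_gt_1[where 'a='a] by simp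
  then have "(-1::'a) = 1"
    using power_card_minus_1[of "-1::'a"] by simp
  then have "of_nat 2 = (0::'a)"
    by (metis add.right_inverse of_nat_numeral one_add_one)
  then have "CHAR('a) dvd 2"
    by (simp only: of_nat_eq_0_iff_char_dvd)
  moreover have "CHAR('a) \<noteq> 1"
    using of_nat_CHAR[where 'a='a] by (metis of_nat_1 zero_neq_one)
  ultimately show ?thesis
    by (metis prime_nat_iff two_is_prime_nat)
qed

lemma power_two_power_add:
  fixes x y :: "'a::field"
  assumes "CHAR('a) = 2"
  shows "(x + y) ^ (2 ^ k) = x ^ (2 ^ k) + y ^ (2 ^ k)"
  by (rule freshmans_dream') (simp_all add: assms)

lemma CHAR_2_add_self:
  fixes x :: "'a::field"
  assumes "CHAR('a) = 2"
  shows "x + x = 0"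
proof -
  have "of_nat 2 = (0::'a)"
    using of_nat_CHAR[where 'a='a] assms by simp
  then show ?thesis
    by (metis mult_2 mult_zero_left of_nat_numeral)
qed

lemma CHAR_2_minus:
  fixes x :: "'a::field"
  assumes "CHAR('a) = 2"
  shows "- x = x"
  using CHAR_2_add_self[OF assms, of x] by (simp add: add_eq_0_iff)

section \<open>The trace\<close>

lemma Tr_add:
  assumes "CHAR('a) = 2"
  shows "Tr k (x + y :: 'a::{field,finite}) = Tr k x + Tr k y"
  unfolding Tr_def by (simp add: power_two_power_add[OF assms] sum.distrib)

lemma Tr_power:
  assumes "CHAR('a) = 2"
  shows "Tr k (x ^ (2 ^ s) :: 'a::{field,finite}) = Tr k x ^ (2 ^ s)"
proof -
  have "Tr k x ^ (2 ^ s) = (\<Sum>j<k. (x ^ (2 ^ j)) ^ (2 ^ s))"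
    unfolding Tr_def by (rule freshmans_dream_sum') (simp_all add: assms)
  then show ?thesis
    unfolding Tr_def by (simp add: mult.commute flip: power_mult)
qed

text \<open>Squaring permutes the summands of the trace cyclically, so the trace is a root of X^2 =
  X.\<close>

lemma Tr_in_prime_field:
  fixes x :: "'a::{field,finite}"
  assumes "CHAR('a) = 2" "x ^ (2 ^ k) = x"
  shows "Tr k x = 0 \<or> Tr k x = 1"
proof -
  have "Tr k x ^ 2 = (\<Sum>j<k. x ^ (2 ^ Suc j))"
    using Tr_power[OF assms(1), of k x 1]
    unfolding Tr_def by (simp flip: power_mult)
  also have "\<dots> = (\<Sum>j<k. x ^ (2 ^ j))"
    using sum.lessThan_Suc_shift[of "\<lambda>j. x ^ (2 ^ j)" k]
    by (simp add: assms(2) add.commute)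
  finally show ?thesis
    unfolding Tr_def[symmetric] by (simp add: power2_eq_square)
qed

lemma Tr_frobenius:
  fixes x :: "'a::{field,finite}"
  assumes "CHAR('a) = 2" "x ^ (2 ^ k) = x"
  shows "Tr k (x ^ (2 ^ s)) = Tr k x"
  using Tr_power[OF assms(1), of k x s] Tr_in_prime_field[OF assms] by auto

lemma sum_lessThan_add:
  fixes g :: "nat \<Rightarrow> 'b::comm_monoid_add"
  shows "(\<Sum>j<k + l. g j) = (\<Sum>j<k. g j) + (\<Sum>j<l. g (j + k))"
  by (induction l) (simp_all add: add_ac)

text \<open>Transitivity of the trace: the upper half of the 2k conjugates is the k-th trace of
  x^(2^k), and x + x^(2^k) is the relative trace.\<close>

lemma Tr_double:
  fixes x :: "'a::{field,finite}"
  assumes "CHAR('a) = 2"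
  shows "Tr (2 * k) x = Tr k (x + x ^ (2 ^ k))"
proof -
  have "Tr (2 * k) x = (\<Sum>j<k. x ^ (2 ^ j)) + (\<Sum>j<k. x ^ (2 ^ (j + k)))"
    unfolding Tr_def mult_2
    using sum_lessThan_add by blast
  also have "\<dots> = Tr k x + Tr k (x ^ (2 ^ k))"
    unfolding Tr_def by (simp add: power_add mult.commute flip: power_mult)
  finally show ?thesis
    by (simp add: Tr_add[OF assms])
qed

lemma minus_one_pow_add:
  fixes c d :: "'a::{field,finite}"
  assumes "CHAR('a) = 2" "c = 0 \<or> c = 1" "d = 0 \<or> d = 1"
  shows "minus_one_pow (c + d) = minus_one_pow c * minus_one_pow d"
  using assms(2,3) CHAR_2_add_self[OF assms(1), of 1]
  by (auto simp: minus_one_pow_def)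

text \<open>The trace is a nonzero polynomial of degree at most 2^(k-1), which bounds its zeros in
  the whole field. Hence it cannot vanish on all of a subfield with 2^k elements.\<close>

lemma card_Tr_kernel_le:
  assumes "k \<ge> 1"
  shows "card {x::'a::{field,finite}. Tr k x = 0} \<le> 2 ^ (k - 1)"
proof -
  define p :: "'a poly" where "p = (\<Sum>j<k. monom 1 (2 ^ j))"
  have "poly p x = Tr k x" for x
    unfolding p_def Tr_def by (simp add: poly_sum poly_monom)
  \<comment> \<open>The exponents 2^j are pairwise distinct, so only the last monomial contributes
    to this coefficient.\<close>
  moreover have "coeff p (2 ^ (k - 1)) = 1"
    using assms unfolding p_def by (simp add: coeff_sum)
  then have "p \<noteq> 0"
    by auto
  moreover have "degree p \<le> 2 ^ (k - 1)"
    unfolding p_def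
    by (rule degree_sum_le) (auto intro!: order.trans[OF degree_monom_le] power_increasing)
  ultimately show ?thesis
    using card_poly_roots_bound[of p] by simp
qed

section \<open>The subfield with $q$ elements\<close>

text \<open>The nonzero fixed points of the q-power map are the solutions of x^(q-1) = 1. As
  \<open>w\<close> has order (q+1)(q-1), these are the powers of \<open>w\<close> whose exponent is
  a multiple of q+1, and there are q-1 of them.\<close>

lemma card_subfield_Fq:
  assumes "CARD('a::{field,finite}) = q ^ 2" "q > 1" "primitive_elem (w::'a)"
  shows "card (subfield_Fq q :: 'a set) = q"
proof -
  have N: "CARD('a) - 1 = (q + 1) * (q - 1)"
    using assms(1,2) by (simp add: power2_eq_square algebra_simps)
  have "subfield_Fq q - {0} = (\<lambda>j. w ^ ((q + 1) * j)) ` {..<q - 1}"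
  proof (intro equalityI subsetI)
    fix x :: 'a assume x: "x \<in> subfield_Fq q - {0}"
    then obtain k where k: "x = w ^ k" "k < (q + 1) * (q - 1)"
      using primitive_elem_image[OF assms(3)] N by (metis Diff_iff UNIV_I imageE lessThan_iff)
    have "x * x ^ (q - 1) = x * 1"
      using x assms(2) by (simp add: subfield_Fq_def flip: power_Suc)
    then have "x ^ (q - 1) = 1"
      using x by simp
    then have "w ^ (k * (q - 1)) = 1"
      unfolding k(1) power_mult .
    then have "(q + 1) * (q - 1) dvd k * (q - 1)"
      by (simp only: primitive_elem_power_eq_1_iff[OF assms(3)] N)
    then have "(q + 1) dvd k"
      using assms(2) dvd_times_right_cancel_iff[of "q - 1" "q + 1" k] by auto
    then obtain j where "k = (q + 1) * j" ..
    then show "x \<in> (\<lambda>j. w ^ ((q + 1) * j)) ` {..<q - 1}"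
      using k by (intro image_eqI[of _ _ j]) (simp_all only: mult_less_cancel1 lessThan_iff)
  next
    fix x :: 'a assume "x \<in> (\<lambda>j. w ^ ((q + 1) * j)) ` {..<q - 1}"
    then obtain j where j: "x = w ^ ((q + 1) * j)" by blast
    have "x ^ (q - 1) = w ^ ((CARD('a) - 1) * j)"
      unfolding j N power_mult[symmetric] by (simp only: mult_ac)
    then have "x ^ (q - 1) = 1"
      by (simp only: primitive_elem_power_eq_1_iff[OF assms(3)] dvd_triv_left)
    then have "x ^ Suc (q - 1) = x"
      by simp
    then show "x \<in> subfield_Fq q - {0}"
      using j assms(2) primitive_elem_nonzero[OF assms(3)] by (simp add: subfield_Fq_def)
  qed
  moreover have "inj_on (\<lambda>j. w ^ ((q + 1) * j)) {..<q - 1}"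
  proof (rule inj_onI)
    fix i j assume ij: "i \<in> {..<q - 1}" "j \<in> {..<q - 1}" "w ^ ((q + 1) * i) = w ^ ((q + 1) * j)"
    then have "(q + 1) * i < CARD('a) - 1" "(q + 1) * j < CARD('a) - 1"
      unfolding N by (simp_all only: mult_less_cancel1) auto
    then have "(q + 1) * i = (q + 1) * j"
      using inj_onD[OF primitive_elem_inj_on[OF assms(3)] ij(3)] by (simp only: lessThan_iff)
    then show "i = j"
      by (subst (asm) mult_cancel1) simp
  qed
  ultimately have "card (subfield_Fq q - {0::'a}) = q - 1"
    by (simp add: card_image)
  moreover have "(0::'a) \<in> subfield_Fq q"
    using assms(2) by (simp add: subfield_Fq_def)
  ultimately show ?thesis
    using assms(2) by (simp add: card_Diff_singleton)
qed

text \<open>Orthogonality of additive characters: for nonzero \<open>c\<close>, a translation by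
  some \<open>y0\<close> with \<open>c * y0\<close> of trace 1 permutes F_q and flips every sign, so
  the sum equals its own negative.\<close>

lemma sum_minus_one_pow_Tr:
  fixes c :: "'a::{field,finite}"
  assumes "CHAR('a) = 2" "q = 2 ^ k" "k \<ge> 1" "card (subfield_Fq q :: 'a set) = q"
    and c: "c \<in> subfield_Fq q"
  shows "(\<Sum>y\<in>subfield_Fq q. minus_one_pow (Tr k (c * y))) = (if c = 0 then int q else 0)"
proof (cases "c = 0")
  case True
  then show ?thesis
    using assms(4) by (simp add: minus_one_pow_def Tr_def power_0_left)
next
  case False
  \<comment> \<open>The kernel of the trace is too small to contain F_q, which yields an element
    \<open>z\<close> of nonzero trace.\<close>
  have "(2::nat) ^ (k - 1) < 2 ^ k"
    using assms(3) by (intro power_strict_increasing) auto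
  then have "card {x::'a. Tr k x = 0} < card (subfield_Fq q :: 'a set)"
    using card_Tr_kernel_le[OF assms(3), where 'a='a] assms(2,4) by linarith
  then have "\<not> (subfield_Fq q :: 'a set) \<subseteq> {x. Tr k x = 0}"
    by (meson card_mono finite leD)
  then obtain z :: 'a where z: "z \<in> subfield_Fq q" "Tr k z \<noteq> 0"
    by blast
  define y0 where "y0 = z / c"
  have y0: "y0 \<in> subfield_Fq q" "c * y0 = z"
    using z c False unfolding y0_def subfield_Fq_def by (simp_all add: power_divide)
  let ?h = "\<lambda>y. minus_one_pow (Tr k (c * y))"
  have "(\<Sum>y\<in>subfield_Fq q. ?h y) = (\<Sum>y\<in>subfield_Fq q. ?h (y + y0))"
    by (rule sum.reindex_bij_witness[of _ "\<lambda>y. y + y0" "\<lambda>y. y + y0"])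
       (use y0 in \<open>simp_all add: subfield_Fq_def assms(2) power_two_power_add[OF assms(1)]
          add.assoc CHAR_2_add_self[OF assms(1)]\<close>)
  also have "\<dots> = (\<Sum>y\<in>subfield_Fq q. - ?h y)"
  proof (rule sum.cong[OF refl])
    fix y :: 'a assume y: "y \<in> subfield_Fq q"
    have 1: "Tr k (c * y) = 0 \<or> Tr k (c * y) = 1" "Tr k z = 0 \<or> Tr k z = 1"
      using y z c assms(2)
      by (intro Tr_in_prime_field[OF assms(1)]; simp add: subfield_Fq_def power_mult_distrib)+
    have "?h (y + y0) = minus_one_pow (Tr k (c * y) + Tr k z)"
      by (simp add: distrib_left y0(2) Tr_add[OF assms(1)])
    then show "?h (y + y0) = - ?h y"
      using minus_one_pow_add[OF assms(1) 1] z(2) by (simp add: minus_one_pow_def)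
  qed
  finally show ?thesis
    using False by (simp add: sum_negf)
qed


section \<open>The polar decomposition of a quadratic extension\<close>

text \<open>The primitive element enters the rest of the argument only through the order of
  \<open>u\<close> and the size of the subfield.\<close>

locale quadratic_extension =
  fixes m q :: nat and u :: "'a::{field,finite}"
  assumes m: "m \<ge> 1" and q: "q = 2 ^ m" and CARD: "CARD('a) = q ^ 2"
    and u_power_eq_1_iff: "u ^ k = 1 \<longleftrightarrow> (q + 1) dvd k"
    and card_Fq: "card (subfield_Fq q :: 'a set) = q"
begin

lemma q_ge_2: "q \<ge> 2"
  using power_increasing[of 1 m "2::nat"] m q by simp

lemma even_q: "even q"
  using m q by simp

lemma CHAR: "CHAR('a) = 2"
  by (rule even_CARD_imp_CHAR_2) (simp add: CARD even_q)

lemma u_nonzero: "u \<noteq> 0"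
  using u_power_eq_1_iff[of "q + 1"] by auto

lemma power_q_add: "(x + y :: 'a) ^ q = x ^ q + y ^ q"
  unfolding q by (rule power_two_power_add[OF CHAR])

lemma power_q_q: "((x :: 'a) ^ q) ^ q = x"
proof (cases "x = 0")
  case False
  have "(x ^ q) ^ q = x ^ (Suc (CARD('a) - 1))"
    using q_ge_2 by (simp add: CARD power2_eq_square flip: power_mult)
  also have "\<dots> = x"
    unfolding power_Suc power_card_minus_1[OF False] by simp
  finally show ?thesis .
qed (use q_ge_2 in simp)

lemma Fq_iff: "(x :: 'a) \<in> subfield_Fq q \<longleftrightarrow> x ^ (2 ^ m) = x"
  by (simp add: subfield_Fq_def q)

lemma Fq_add: "x \<in> subfield_Fq q \<Longrightarrow> y \<in> subfield_Fq q \<Longrightarrow> x + y \<in> (subfield_Fq q :: 'a set)"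
  by (simp add: subfield_Fq_def power_q_add)

lemma Fq_mult: "x \<in> subfield_Fq q \<Longrightarrow> y \<in> subfield_Fq q \<Longrightarrow> x * y \<in> (subfield_Fq q :: 'a set)"
  by (simp add: subfield_Fq_def power_mult_distrib)

lemma Fq_power: "x \<in> subfield_Fq q \<Longrightarrow> x ^ k \<in> (subfield_Fq q :: 'a set)"
  unfolding subfield_Fq_def mem_Collect_eq by (metis mult.commute power_mult)

lemma zero_in_Fq: "0 \<in> (subfield_Fq q :: 'a set)"
  using q_ge_2 by (simp add: subfield_Fq_def)

lemma Fq_power_q_minus_1:
  assumes "y \<in> subfield_Fq q - {0::'a}"
  shows "y ^ (q - 1) = 1"
proof -
  have "y * y ^ (q - 1) = y * 1"
    using assms q_ge_2 by (simp add: subfield_Fq_def flip: power_Suc)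
  then show ?thesis
    using assms by simp
qed

section \<open>Conjugation on the powers of \<open>u\<close> and relative traces of z u^k\<close>

lemma u_power_q: "(u ^ k) ^ q = inverse (u ^ k)"
proof -
  have "(u ^ k) ^ q * u ^ k = u ^ ((q + 1) * k)"
    by (simp add: algebra_simps flip: power_mult power_add)
  also have "\<dots> = 1"
    by (simp only: u_power_eq_1_iff dvd_triv_left)
  finally show ?thesis
    by (metis inverse_unique mult.commute)
qed

lemma trace_form_in_Fq: "z * u ^ k + z ^ q * inverse (u ^ k) \<in> subfield_Fq q"
proof -
  \<comment> \<open>The expression is the relative trace of z u^k, since conjugation inverts u^k.
    The q-th power merely swaps its two summands.\<close>
  have "(z * u ^ k + z ^ q * inverse (u ^ k)) ^ q
      = z ^ q * (u ^ k) ^ q + (z ^ q) ^ q * inverse ((u ^ k) ^ q)"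
    by (simp add: power_q_add power_mult_distrib power_inverse)
  then show ?thesis
    unfolding subfield_Fq_def by (simp add: u_power_q power_q_q add.commute)
qed

text \<open>Transitivity of the trace; the factor \<open>y\<close> is fixed by conjugation and can
  be pulled out of the relative trace.\<close>

lemma Tr_double_coset:
  assumes "y \<in> subfield_Fq q"
  shows "Tr (2 * m) (z * u ^ k * y) = Tr m ((z * u ^ k + z ^ q * inverse (u ^ k)) * y)"
proof -
  have "(z * u ^ k * y) ^ (2 ^ m) = z ^ q * inverse (u ^ k) * y"
    using assms unfolding q[symmetric] subfield_Fq_def
    by (simp add: power_mult_distrib u_power_q)
  then show ?thesis
    by (simp add: Tr_double[OF CHAR] distrib_right)
qed

text \<open>For nonzero \<open>z\<close>, factoring out z u^(-k) leaves u^(2k) + z^(q-1), and in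
  characteristic two a vanishing sum means equal summands.\<close>

lemma trace_form_eq_0_iff:
  "z * u ^ k + z ^ q * inverse (u ^ k) = 0 \<longleftrightarrow> z = 0 \<or> z ^ (q - 1) = u ^ (2 * k)"
proof (cases "z = 0")
  case True
  then show ?thesis
    using q_ge_2 by simp
next
  case False
  have "z ^ q = z * z ^ (q - 1)"
    using q_ge_2 by (simp flip: power_Suc)
  then have "z * u ^ k + z ^ q * inverse (u ^ k) = z * inverse (u ^ k) * (u ^ (2 * k) + z ^ (q - 1))"
    using u_nonzero by (simp add: field_simps power_mult_distrib mult_2_right flip: power_add)
  also have "\<dots> = 0 \<longleftrightarrow> u ^ (2 * k) = - (z ^ (q - 1))"
    using False u_nonzero by (simp add: eq_neg_iff_add_eq_0)
  finally show ?thesis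
    using False CHAR_2_minus[OF CHAR, of "z ^ (q - 1)"] by auto
qed

section \<open>Unique representation of nonzero elements as u^i y\<close>

lemma u_power_double_inj:
  assumes "i \<le> q" "j \<le> q" "u ^ (2 * i) = u ^ (2 * j)"
  shows "i = j"
  using assms
proof (induction i j rule: linorder_wlog)
  case (le i j)
  then have "2 * i + 2 * (j - i) = 2 * j"
    by simp
  then have "u ^ (2 * i) * u ^ (2 * (j - i)) = u ^ (2 * i) * 1"
    unfolding power_add[symmetric] using le by simp
  then have "(q + 1) dvd 2 * (j - i)"
    using u_nonzero u_power_eq_1_iff by simp
  \<comment> \<open>As q+1 is odd, doubling of exponents is invertible modulo the order of
    \<open>u\<close>.\<close>
  moreover have "coprime (q + 1) 2"
    using even_q by simp
  ultimately have "(q + 1) dvd j - i"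
    by (simp only: coprime_dvd_mult_right_iff)
  then show ?case
    using le by (auto dest!: dvd_imp_le)
qed simp

lemma bij_betw_polar:
  "bij_betw (\<lambda>(i, y). u ^ i * y) ({0..q} \<times> (subfield_Fq q - {0})) (UNIV - {0})"
proof -
  have inj: "inj_on (\<lambda>(i, y). u ^ i * y) ({0..q} \<times> (subfield_Fq q - {0}))"
  proof (rule inj_onI)
    fix p p' assume p: "p \<in> {0..q} \<times> (subfield_Fq q - {0})" "p' \<in> {0..q} \<times> (subfield_Fq q - {0})"
      and eq: "(\<lambda>(i, y). u ^ i * y) p = (\<lambda>(i, y). u ^ i * y) p'"
    obtain i y j z where pp: "p = (i, y)" "p' = (j, z)"
      by (cases p, cases p')
    note * = p[unfolded pp] eq[unfolded pp prod.case]
    \<comment> \<open>The (q-1)-th power kills the factor from F_q and turns u^k into u^(-2k), so it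
      recovers the index of the coset.\<close>
    have pow: "u ^ (2 * k) * (u ^ k * x) ^ (q - 1) = 1"
      if "x \<in> subfield_Fq q - {0}" for k x
    proof -
      have "u ^ (2 * k) * (u ^ k * x) ^ (q - 1) = u ^ (2 * k + k * (q - 1))"
        using Fq_power_q_minus_1[OF that] by (simp add: power_mult_distrib power_add power_mult)
      also have "2 * k + k * (q - 1) = (q + 1) * k"
        using q_ge_2 by (cases q) (simp_all add: algebra_simps)
      also have "u ^ ((q + 1) * k) = 1"
        by (simp only: u_power_eq_1_iff dvd_triv_left)
      finally show ?thesis .
    qed
    have "u ^ (2 * i) * (u ^ i * y) ^ (q - 1) = u ^ (2 * j) * (u ^ i * y) ^ (q - 1)"
      using pow[of y i] pow[of z j] * by simp
    moreover have "(u ^ i * y) ^ (q - 1) \<noteq> 0"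
      using * u_nonzero by simp
    ultimately have "i = j"
      using * by (intro u_power_double_inj) auto
    then show "p = p'"
      using * u_nonzero by (simp add: pp)
  qed
  \<comment> \<open>Surjectivity follows by counting: (q+1)(q-1) = q^2 - 1.\<close>
  have "card ((\<lambda>(i, y). u ^ i * y) ` ({0..q} \<times> (subfield_Fq q - {0}))) = (q + 1) * (q - 1)"
    using card_image[OF inj] zero_in_Fq by (simp add: card_cartesian_product card_Diff_singleton card_Fq)
  also have "\<dots> = card (UNIV - {0::'a})"
    using q_ge_2 by (simp add: card_Diff_singleton CARD power2_eq_square algebra_simps)
  finally have "(\<lambda>(i, y). u ^ i * y) ` ({0..q} \<times> (subfield_Fq q - {0})) = UNIV - {0}"
    using u_nonzero by (intro card_subset_eq) auto
  then show ?thesis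
    using inj by (simp add: bij_betw_def)
qed

text \<open>If z = u^i y with \<open>y\<close> in F_q, then z^(q-1) = u^(-2i), so \<open>t\<close>
  is the representative of -i modulo q+1.\<close>

lemma power_q_minus_1_eq_u_power:
  assumes "z \<noteq> 0"
  obtains t where "t \<in> {0..q}" "z ^ (q - 1) = u ^ (2 * t)"
proof -
  have "z \<in> (\<lambda>(i, y). u ^ i * y) ` ({0..q} \<times> (subfield_Fq q - {0}))"
    unfolding bij_betw_imp_surj_on[OF bij_betw_polar] using assms by simp
  then obtain i y where i: "i \<in> {0..q}" and y: "y \<in> subfield_Fq q - {0}" and z: "z = u ^ i * y"
    by (elim imageE SigmaE) simp
  have "z ^ (q - 1) * u ^ (2 * i) = u ^ (i * (q - 1) + 2 * i)"
    using Fq_power_q_minus_1[OF y] unfolding z by (simp add: power_mult_distrib power_add power_mult)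
  also have "i * (q - 1) + 2 * i = (q + 1) * i"
    using q_ge_2 by (cases q) (simp_all add: algebra_simps)
  also have "u ^ ((q + 1) * i) = 1"
    by (simp only: u_power_eq_1_iff dvd_triv_left)
  finally have 1: "z ^ (q - 1) * u ^ (2 * i) = 1" .
  \<comment> \<open>The representative q+1-i of -i lies in the range 0..q only for nonzero
    \<open>i\<close>.\<close>
  show ?thesis
  proof (cases "i = 0")
    case True
    then show ?thesis
      using 1 that[of 0] by simp
  next
    case False
    have "u ^ (2 * (q + 1 - i)) * u ^ (2 * i) = u ^ ((q + 1) * 2)"
      using i by (simp flip: power_add) (simp add: algebra_simps)
    also have "\<dots> = 1"
      by (simp only: u_power_eq_1_iff dvd_triv_left)
    finally have "z ^ (q - 1) * u ^ (2 * i) = u ^ (2 * (q + 1 - i)) * u ^ (2 * i)"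
      using 1 by simp
    then show ?thesis
      using u_nonzero False that[of "q + 1 - i"] by simp
  qed
qed

section \<open>Frobenius roots and exponents congruent to powers of two\<close>

lemma root_pow2:
  assumes "(y :: 'a) \<in> subfield_Fq q"
  shows root_pow2_in_Fq: "root_pow2 q t y \<in> subfield_Fq q"
    and root_pow2_power: "root_pow2 q t y ^ (2 ^ nat t) = y ^ (2 ^ nat (- t))"
proof -
  let ?F = "subfield_Fq q :: 'a set" and ?p = "\<lambda>z::'a. z ^ (2 ^ nat t)"
  have inj: "inj_on ?p ?F"
  proof (rule inj_onI)
    fix z w :: 'a assume "?p z = ?p w"
    then have "(z + w) ^ (2 ^ nat t) = 0"
      by (simp add: power_two_power_add[OF CHAR] CHAR_2_add_self[OF CHAR])
    then show "z = w"
      using CHAR_2_minus[OF CHAR, of w] by (simp add: add_eq_0_iff2)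
  qed
  \<comment> \<open>An injective self-map of a finite set is onto, so the root exists as well as
    being unique, and the description in \<open>root_pow2\<close> is proper.\<close>
  have "?p ` ?F = ?F"
    by (rule card_subset_eq) (auto simp: card_image[OF inj] intro: Fq_power)
  then have "y ^ (2 ^ nat (- t)) \<in> ?p ` ?F"
    using Fq_power[OF assms] by simp
  then obtain z where "y ^ (2 ^ nat (- t)) = ?p z" "z \<in> ?F"
    by (rule imageE)
  then have "\<exists>!z. z \<in> ?F \<and> ?p z = y ^ (2 ^ nat (- t))"
    using inj by (auto dest: inj_onD)
  from theI'[OF this]
  show "(root_pow2 q t y :: 'a) \<in> ?F" "root_pow2 q t y ^ (2 ^ nat t) = y ^ (2 ^ nat (- t))"
    unfolding root_pow2_def by auto
qed

text \<open>The left argument raised to 2^(nat (-t)) agrees with the right one raised to 2^(nat t),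
  and such powers do not change the trace of elements of F_q. This treats both signs of
  \<open>t\<close> at once.\<close>

lemma Tr_mult_power_cong_pow2:
  assumes "(c :: 'a) \<in> subfield_Fq q" "y \<in> subfield_Fq q - {0}" "cong_pow2 r t (q - 1)"
  shows "Tr m (c * y ^ r) = Tr m (root_pow2 q t c * y)"
proof -
  have "y ^ (r * 2 ^ nat (- t)) = y ^ (2 ^ nat t)"
    using power_mod_eq[OF Fq_power_q_minus_1[OF assms(2)]] assms(3)
    unfolding cong_pow2_def cong_def by metis
  then have "(c * y ^ r) ^ (2 ^ nat (- t)) = (root_pow2 q t c * y) ^ (2 ^ nat t)"
    by (simp add: power_mult_distrib root_pow2_power[OF assms(1)] flip: power_mult)
  moreover have "c * y ^ r \<in> subfield_Fq q" "root_pow2 q t c * y \<in> subfield_Fq q"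
    using assms by (auto intro: Fq_mult Fq_power root_pow2_in_Fq)
  ultimately show ?thesis
    using Tr_frobenius[OF CHAR] Fq_iff by metis
qed

section \<open>Character sums over single cosets and their total\<close>

lemma sum_Fq_nonzero:
  assumes "(c :: 'a) \<in> subfield_Fq q"
  shows "(\<Sum>y\<in>subfield_Fq q - {0}. minus_one_pow (Tr m (c * y))) = (if c = 0 then int q else 0) - 1"
proof -
  have "(\<Sum>y\<in>subfield_Fq q. minus_one_pow (Tr m (c * y)))
      = minus_one_pow (Tr m (c * 0)) + (\<Sum>y\<in>subfield_Fq q - {0}. minus_one_pow (Tr m (c * y)))"
    using zero_in_Fq by (intro sum.remove) auto
  then show ?thesis
    using sum_minus_one_pow_Tr[OF CHAR q m card_Fq assms]
    by (simp add: Tr_def minus_one_pow_def power_0_left)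
qed

text \<open>Here y^r = 1 for every nonzero \<open>y\<close> in F_q, so the term with
  \<open>d\<close> is a constant sign that factors out.\<close>

lemma sum_Fq_constant_power:
  assumes "(c :: 'a) \<in> subfield_Fq q" "(d :: 'a) \<in> subfield_Fq q" "[r = 0] (mod (q - 1))"
  shows "(\<Sum>y\<in>subfield_Fq q - {0}. minus_one_pow (Tr m (d * y ^ r + c * y)))
    = minus_one_pow (Tr m d) * ((if c = 0 then int q else 0) - 1)"
proof -
  have "minus_one_pow (Tr m (d * y ^ r + c * y)) = minus_one_pow (Tr m d) * minus_one_pow (Tr m (c * y))"
    if y: "y \<in> subfield_Fq q - {0}" for y
  proof -
    have "y ^ r = 1"
      using power_mod_eq[OF Fq_power_q_minus_1[OF y], of r] assms(3)
      unfolding cong_def by simp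
    moreover have "Tr m d = 0 \<or> Tr m d = 1"
      using assms(2) Fq_iff by (intro Tr_in_prime_field[OF CHAR]) blast
    moreover have "Tr m (c * y) = 0 \<or> Tr m (c * y) = 1"
      using Fq_mult[OF assms(1), of y] y Fq_iff by (intro Tr_in_prime_field[OF CHAR]) blast
    ultimately show ?thesis
      by (simp add: Tr_add[OF CHAR] minus_one_pow_add[OF CHAR])
  qed
  then show ?thesis
    by (simp add: sum_Fq_nonzero[OF assms(1)] flip: sum_distrib_left)
qed

text \<open>The power y^r can be traded for \<open>y\<close> at the cost of replacing
  \<open>d\<close> by its root. What remains is a linear character, trivial exactly if
  \<open>c\<close> equals that root.\<close>

lemma sum_Fq_linear_power:
  assumes "(c :: 'a) \<in> subfield_Fq q" "(d :: 'a) \<in> subfield_Fq q" "cong_pow2 r t (q - 1)"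
  shows "(\<Sum>y\<in>subfield_Fq q - {0}. minus_one_pow (Tr m (d * y ^ r + c * y)))
    = (if c = root_pow2 q t d then int q else 0) - 1"
proof -
  have "Tr m (d * y ^ r + c * y) = Tr m ((root_pow2 q t d + c) * y)"
    if "y \<in> subfield_Fq q - {0}" for y
    using Tr_mult_power_cong_pow2[OF assms(2) that assms(3)]
    by (simp add: Tr_add[OF CHAR] distrib_right)
  moreover have "root_pow2 q t d + c = 0 \<longleftrightarrow> c = root_pow2 q t d"
    by (simp only: add_eq_0_iff CHAR_2_minus[OF CHAR])
  ultimately show ?thesis
    using sum_Fq_nonzero[OF Fq_add[OF root_pow2_in_Fq[OF assms(2)] assms(1)], of t] by simp
qed

lemma walsh_polar:
  assumes "f 0 = 0"
    and f: "\<And>i y. i \<in> {0..q} \<Longrightarrow> y \<in> subfield_Fq q - {0} \<Longrightarrow>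
      f (u ^ i * y) = Tr (2 * m) (a i * (u ^ i * y) ^ r i)"
  shows "walsh (2 * m) f b = 1 + (\<Sum>i\<in>{0..q}. \<Sum>y\<in>subfield_Fq q - {0}. minus_one_pow (Tr m
    ((a i * u ^ (i * r i) + a i ^ q * inverse (u ^ (i * r i))) * y ^ r i
      + (b * u ^ i + b ^ q * inverse (u ^ i)) * y)))"
proof -
  let ?g = "\<lambda>x. minus_one_pow (f x + Tr (2 * m) (b * x))"
  have "walsh (2 * m) f b = ?g 0 + (\<Sum>x\<in>UNIV - {0}. ?g x)"
    unfolding walsh_def by (rule sum.remove) auto
  also have "?g 0 = 1"
    using assms(1) by (simp add: minus_one_pow_def Tr_def power_0_left)
  also have "(\<Sum>x\<in>UNIV - {0}. ?g x) = (\<Sum>i\<in>{0..q}. \<Sum>y\<in>subfield_Fq q - {0}. ?g (u ^ i * y))"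
    unfolding sum.reindex_bij_betw[OF bij_betw_polar, symmetric] sum.cartesian_product
    by (simp add: case_prod_unfold)
  also have "\<dots> = (\<Sum>i\<in>{0..q}. \<Sum>y\<in>subfield_Fq q - {0}. minus_one_pow (Tr m
    ((a i * u ^ (i * r i) + a i ^ q * inverse (u ^ (i * r i))) * y ^ r i
      + (b * u ^ i + b ^ q * inverse (u ^ i)) * y)))"
  proof (intro sum.cong[OF refl] arg_cong[where f = minus_one_pow])
    fix i y assume i: "i \<in> {0..q}" and y: "y \<in> subfield_Fq q - {0::'a}"
    have "f (u ^ i * y) = Tr (2 * m) (a i * u ^ (i * r i) * y ^ r i)"
      unfolding f[OF i y] by (simp add: power_mult_distrib power_mult mult.assoc)
    moreover have "y \<in> subfield_Fq q" "y ^ r i \<in> subfield_Fq q"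
      using y by (auto intro: Fq_power)
    ultimately show "f (u ^ i * y) + Tr (2 * m) (b * (u ^ i * y)) = Tr m
        ((a i * u ^ (i * r i) + a i ^ q * inverse (u ^ (i * r i))) * y ^ r i
          + (b * u ^ i + b ^ q * inverse (u ^ i)) * y)"
      using Tr_double_coset[of y b i] Tr_double_coset[of "y ^ r i" "a i" "i * r i"]
      by (simp add: Tr_add[OF CHAR] mult.assoc)
  qed
  finally show ?thesis .
qed

end

text \<open>The power of the primitive element with exponent q-1 has order q+1. For e = 2^(2m-1) - 1
  one has 2e + 1 = q^2 - 1, so a common divisor of \<open>e\<close> and q+1 divides 1, and the e-th
  power keeps this order.\<close>

lemma quadratic_extension_primitive_elem:
  fixes \<omega> :: "'a::{field,finite}"
  assumes "m \<ge> 1" "q = 2 ^ m" "CARD('a) = q ^ 2" "primitive_elem \<omega>"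
  shows "quadratic_extension m q (\<omega> ^ ((q - 1) * (2 ^ (2 * m - 1) - 1)))"
proof
  have q2: "q \<ge> 2"
    using power_increasing[of 1 m "2::nat"] assms(1,2) by simp
  have N: "CARD('a) - 1 = (q - 1) * (q + 1)"
    using assms(3) q2 by (simp add: power2_eq_square algebra_simps)
  let ?e = "2 ^ (2 * m - 1) - 1 :: nat"
  have "2 * 2 ^ (2 * m - 1) = (2::nat) ^ (2 * m)"
    using assms(1) by (simp flip: power_Suc)
  also have "\<dots> = q * q"
    unfolding assms(2) by (simp add: mult_2 power_add)
  finally have "2 * 2 ^ (2 * m - 1) = q * q" .
  moreover have "(2::nat) ^ (2 * m - 1) \<ge> 1"
    by simp
  ultimately have "2 * ?e + 2 = q * q"
    by linarith
  moreover have "(q - 1) * (q + 1) + 1 = q * q"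
    using q2 by (cases q) (simp_all add: algebra_simps)
  ultimately have e: "2 * ?e + 1 = (q - 1) * (q + 1)"
    by linarith
  have "coprime (q + 1) ?e"
  proof (rule coprimeI)
    fix d assume d: "d dvd q + 1" "d dvd ?e"
    then have "d dvd 2 * ?e + 1"
      unfolding e using d(1) by (intro dvd_mult)
    then show "is_unit d"
      using d(2) by (metis dvd_add_right_iff dvd_mult)
  qed
  then show "(\<omega> ^ ((q - 1) * ?e)) ^ k = 1 \<longleftrightarrow> (q + 1) dvd k" for k
    unfolding power_mult[symmetric] primitive_elem_power_eq_1_iff[OF assms(4)] N
    using q2 by (simp only: mult.assoc dvd_times_left_cancel_iff coprime_dvd_mult_right_iff)
  show "card (subfield_Fq q :: 'a set) = q"
    using card_subfield_Fq[OF assms(3) _ assms(4)] q2 by simp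
qed (use assms in auto)

theorem theorem3p1:
  fixes m n q :: nat
    and \<omega> u :: "'a::{field,finite}"
    and r :: "nat \<Rightarrow> nat" and a \<alpha> :: "nat \<Rightarrow> 'a"
    and R0 R1 :: "nat set" and \<tau> :: "nat \<Rightarrow> int"
    and f :: "'a \<Rightarrow> 'a"
    and M0 :: int and T :: "nat \<Rightarrow> 'a \<Rightarrow> int"
    and b :: 'a
  assumes "m \<ge> 1" and "n = 2 * m" and "q = 2 ^ m" and "CARD('a) = q ^ 2"
    and "primitive_elem \<omega>" and "u = \<omega> ^ ((q - 1) * (2 ^ (n - 1) - 1))"
    and "R0 = {i \<in> {0..q}. [r i = 0] (mod (q - 1))}"
    and "R1 = {i \<in> {0..q}. \<exists>t. cong_pow2 (r i) t (q - 1)}"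
    and "\<forall>i\<in>R1. cong_pow2 (r i) (\<tau> i) (q - 1)"
    and "card R0 + card R1 = q + 1"
    and "range f \<subseteq> {0, 1}" and "f 0 = 0"
    and "\<forall>i\<in>{0..q}. \<forall>y\<in>subfield_Fq q - {0}. f (u ^ i * y) = Tr n (a i * (u ^ i * y) ^ r i)"
    and "\<alpha> = (\<lambda>i. a i * u ^ (i * r i) + a i ^ q * u powi (- int (i * r i)))"
    and "M0 = (\<Sum>i\<in>R0. minus_one_pow (Tr m (\<alpha> i)))"
    and "T = (\<lambda>i c. if c * u ^ i + c ^ q * u powi (- int i) = root_pow2 q (\<tau> i) (\<alpha> i)
                     then 1 else 0)"
  shows "(b = 0 \<longrightarrow>
            walsh n f b = int q * (M0 + (\<Sum>i\<in>R1. T i b)) - (M0 + int (card R1) - 1)) \<and>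
         (\<forall>t\<in>R0. b ^ (q - 1) = u ^ (2 * t) \<longrightarrow>
            walsh n f b = int q * (minus_one_pow (Tr m (\<alpha> t)) + (\<Sum>i\<in>R1. T i b))
                            - (M0 + int (card R1) - 1)) \<and>
         (\<forall>t\<in>R1. b ^ (q - 1) = u ^ (2 * t) \<longrightarrow>
            walsh n f b = int q * (\<Sum>i\<in>R1. T i b) - (M0 + int (card R1) - 1)) \<and>
         (b \<noteq> 0 \<longrightarrow> (\<exists>t\<in>R0 \<union> R1. b ^ (q - 1) = u ^ (2 * t)))"
proof -
  note m = assms(1) and n = assms(2) and q = assms(3)
  note R0 = assms(7) and R1 = assms(8) and \<alpha> = assms(14) and M0 = assms(15) and T = assms(16)
  interpret quadratic_extension m q u
    unfolding assms(6) n by (rule quadratic_extension_primitive_elem[OF m q assms(4,5)])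
  define c where "c i = b * u ^ i + b ^ q * inverse (u ^ i)" for i
  have c_Fq: "c i \<in> subfield_Fq q" for i
    unfolding c_def by (rule trace_form_in_Fq)
  have c_eq_0: "c i = 0 \<longleftrightarrow> b = 0 \<or> b ^ (q - 1) = u ^ (2 * i)" for i
    unfolding c_def by (rule trace_form_eq_0_iff)
  have \<alpha>_eq: "\<alpha> i = a i * u ^ (i * r i) + a i ^ q * inverse (u ^ (i * r i))" for i
    unfolding \<alpha> by (simp add: power_int_minus del: of_nat_mult)
  have \<alpha>_Fq: "\<alpha> i \<in> subfield_Fq q" for i
    unfolding \<alpha>_eq by (rule trace_form_in_Fq)
  have T_eq: "T i b = (if c i = root_pow2 q (\<tau> i) (\<alpha> i) then 1 else 0)" for i
    unfolding T c_def by (simp add: power_int_minus)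

  have fin: "finite R0" "finite R1"
    unfolding R0 R1 by simp_all
  \<comment> \<open>For q = 2 the modulus is 1 and all congruences hold, so both index sets would be
    everything and their sizes would add up to 2(q+1).\<close>
  have "q - 1 \<noteq> 1"
  proof
    assume "q - 1 = 1"
    then have "R0 = {0..q}" "R1 = {0..q}"
      unfolding R0 R1 by (auto simp: cong_pow2_def cong_def)
    then show False
      using assms(10) by simp
  qed
  \<comment> \<open>A common index would make the odd number q-1 divide a power of two.\<close>
  have disj: "R0 \<inter> R1 = {}"
  proof (rule equals0I)
    fix i assume i: "i \<in> R0 \<inter> R1"
    then have "(q - 1) dvd r i * 2 ^ nat (- \<tau> i)"
      unfolding R0 by (simp add: cong_0_iff)
    then have "(q - 1) dvd 2 ^ nat (\<tau> i)"
      using i assms(9) unfolding cong_pow2_def by (metis IntD2 cong_dvd_iff)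
    moreover have "coprime (q - 1) (2 ^ nat (\<tau> i))"
      using even_q q_ge_2 by simp
    ultimately have "q - 1 = 1"
      by (metis coprime_absorb_left nat_dvd_1_iff_1)
    then show False
      using \<open>q - 1 \<noteq> 1\<close> by blast
  qed
  have un: "R0 \<union> R1 = {0..q}"
    using card_Un_disjoint[OF fin disj] assms(10) unfolding R0 R1
    by (intro card_subset_eq) auto

  let ?\<epsilon> = "\<lambda>i. minus_one_pow (Tr m (\<alpha> i))"
  let ?S = "\<lambda>i. \<Sum>y\<in>subfield_Fq q - {0}. minus_one_pow (Tr m (\<alpha> i * y ^ r i + c i * y))"
  have "walsh n f b = 1 + sum ?S {0..q}"
    unfolding n \<alpha>_eq c_def using assms(12,13) by (intro walsh_polar) (auto simp: n)
  also have "sum ?S {0..q} = sum ?S R0 + sum ?S R1"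
    unfolding un[symmetric] by (rule sum.union_disjoint[OF fin disj])
  also have "sum ?S R0 = (\<Sum>i\<in>R0. ?\<epsilon> i * ((if c i = 0 then int q else 0) - 1))"
    using sum_Fq_constant_power[OF c_Fq \<alpha>_Fq] unfolding R0 by (intro sum.cong) auto
  also have "\<dots> = int q * (\<Sum>i\<in>R0. if c i = 0 then ?\<epsilon> i else 0) - M0"
    unfolding M0 sum_distrib_left sum_subtractf[symmetric]
    by (intro sum.cong refl) (simp add: algebra_simps)
  also have "sum ?S R1 = (\<Sum>i\<in>R1. int q * T i b - 1)"
  proof (rule sum.cong[OF refl])
    fix i assume "i \<in> R1"
    then have "cong_pow2 (r i) (\<tau> i) (q - 1)"
      using assms(9) by blast
    then show "?S i = int q * T i b - 1"
      by (simp add: sum_Fq_linear_power[OF c_Fq \<alpha>_Fq] T_eq del: One_nat_def)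
  qed
  also have "\<dots> = int q * (\<Sum>i\<in>R1. T i b) - int (card R1)"
    by (simp add: sum_subtractf sum_distrib_left)
  \<comment> \<open>The constant collects 1 from x = 0, -M0 from the cosets in \<open>R0\<close> and
    -1 from each coset in \<open>R1\<close>. All cases of the result differ only in the sum over
    \<open>R0\<close>.\<close>
  finally have walsh: "walsh n f b
      = int q * ((\<Sum>i\<in>R0. if c i = 0 then ?\<epsilon> i else 0) + (\<Sum>i\<in>R1. T i b)) - (M0 + int (card R1) - 1)"
    by (simp add: algebra_simps)

  have sum_c: "(\<Sum>i\<in>R0. if c i = 0 then ?\<epsilon> i else 0) = (if t \<in> R0 then ?\<epsilon> t else 0)"
    if t: "t \<in> R0 \<union> R1" "b ^ (q - 1) = u ^ (2 * t)" for t
  proof -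
    \<comment> \<open>Since q-1 is positive, b = 0 would make a power of \<open>u\<close>
      vanish.\<close>
    have "b \<noteq> 0"
      using t(2) u_nonzero q_ge_2 by (auto simp: power_0_left)
    then have "c i = 0 \<longleftrightarrow> i = t" if "i \<in> R0" for i
    proof -
      have "i \<le> q" "t \<le> q"
        using that t(1) un by auto
      then show ?thesis
        using \<open>b \<noteq> 0\<close> t(2) u_power_double_inj[of t i] unfolding c_eq_0 by auto
    qed
    \<comment> \<open>Only the index \<open>t\<close> has a vanishing linear coefficient, and it
      contributes here only if it belongs to \<open>R0\<close>.\<close>
    then have "(\<Sum>i\<in>R0. if c i = 0 then ?\<epsilon> i else 0) = (\<Sum>i\<in>R0. if i = t then ?\<epsilon> i else 0)"
      by (intro sum.cong) auto
    then show ?thesis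
      using fin by simp
  qed
  \<comment> \<open>For b = 0 every \<open>c i\<close> vanishes, so the sum over \<open>R0\<close>
    is all of M0.\<close>
  have "walsh n f b = int q * (M0 + (\<Sum>i\<in>R1. T i b)) - (M0 + int (card R1) - 1)" if "b = 0"
    unfolding walsh M0 using that by (simp add: c_eq_0)
  moreover have "walsh n f b = int q * (?\<epsilon> t + (\<Sum>i\<in>R1. T i b)) - (M0 + int (card R1) - 1)"
    if "t \<in> R0" "b ^ (q - 1) = u ^ (2 * t)" for t
    unfolding walsh using sum_c[of t] that by simp
  moreover have "walsh n f b = int q * (\<Sum>i\<in>R1. T i b) - (M0 + int (card R1) - 1)"
    if "t \<in> R1" "b ^ (q - 1) = u ^ (2 * t)" for t
  proof -
    have "t \<notin> R0"
      using that(1) disj by blast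
    then show ?thesis
      unfolding walsh using sum_c[of t] that by simp
  qed
  \<comment> \<open>This makes the case distinction exhaustive.\<close>
  moreover have "\<exists>t\<in>R0 \<union> R1. b ^ (q - 1) = u ^ (2 * t)" if "b \<noteq> 0"
    unfolding un using power_q_minus_1_eq_u_power[OF that] by blast
  ultimately show ?thesis
    by blast
qed

end
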